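(* The Kolmogorov semantics $\mu^{\mathsf K}$ is a double negation semantics for the class of all bounded pocrims (the class of models of intuitionistic affine logic $\mathbf{AL}_{\mathbf i}$).
   Context: A pocrim is a structure $\mathbf{P}=(P;0,+,\rightarrow)$ such that, writing $x\ge y$ for $x\rightarrow y=0$: $(P;0,+)$ is a commutative monoid; $\ge$ is a partial order on $P$; $x\ge y$ implies $x+z\ge y+z$; $x\ge 0$ for all $x$; and $x+y\ge z$ iff $x\ge y\rightarrow z$. A pocrim is bounded if it has an element $1$ with $x+1=1$ for all $x$; then $\neg x=x\rightarrow 1$ and $\delta(x)=\neg\neg x$. A bounded pocrim is involutive if $\delta(x)=x$ for all $x$. Homomorphisms of bounded pocrims preserve $0,1,+,\rightarrow$. $\mathcal{L}$ is the set of formulas built from a countable set of variables $\mathrm{Var}=\{V_1,V_2,\ldots\}$ and the constant $1$ using binary connectives $\otimes$ and $\multimap$. A semantics is a family $\mu$ of functions $\mu_{\mathbf P}$, one for each bounded pocrim $\mathbf{P}$, mapping each assignment $\alpha:\mathrm{Var}\to P$ to a function $\mu_{\mathbf P}(\alpha):\mathcal{L}\to P$, that is natural: for every homomorphism of bounded pocrims $h:\mathbf{P}\to\mathbf{Q}$, $\mu_{\mathbf Q}(h\circ\alpha)=h\circ\mu_{\mathbf P}(\alpha)$. The standard semantics $\mu^{\mathsf S}$ is given by $\mu^{\mathsf S}_{\mathbf P}(\alpha)(V_i)=\alpha(V_i)$, $\mu^{\mathsf S}_{\mathbf P}(\alpha)(1)=1$, and interpreting $\otimes$ as $+$ and $\multimap$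 as $\rightarrow$. The Kolmogorov semantics is given recursively by $\mu^{\mathsf K}_{\mathbf P}(\alpha)(V_i)=\delta(\alpha(V_i))$, $\mu^{\mathsf K}_{\mathbf P}(\alpha)(1)=1$, $\mu^{\mathsf K}_{\mathbf P}(\alpha)(A\otimes B)=\delta(\mu^{\mathsf K}_{\mathbf P}(\alpha)(A)+\mu^{\mathsf K}_{\mathbf P}(\alpha)(B))$, $\mu^{\mathsf K}_{\mathbf P}(\alpha)(A\multimap B)=\delta(\mu^{\mathsf K}_{\mathbf P}(\alpha)(A)\rightarrow\mu^{\mathsf K}_{\mathbf P}(\alpha)(B))$. For a class $\mathcal{C}$ of bounded pocrims, a semantics $\mu$ is a double negation semantics for $\mathcal{C}$ if: (DNS1) if $\mathbf{P}\in\mathcal{C}$ is involutive then $\mu_{\mathbf P}=\mu^{\mathsf S}_{\mathbf P}$; (DNS2) for every formula $A$, if $\mu^{\mathsf S}_{\mathbf P}(\alpha)(A)=0$ for every involutive $\mathbf{P}\in\mathcal{C}$ and every $\alpha:\mathrm{Var}\to P$, then $\mu_{\mathbf P}(\alpha)(A)=0$ for every $\mathbf{P}\in\mathcal{C}$ and every $\alpha:\mathrm{Var}\to P$; (DNS3) $\delta\circ\mu_{\mathbf P}(\alpha)=\mu_{\mathbf P}(\alpha)$ for all $\mathbf{P}\in\mathcal{C}$ and all $\alpha:\mathrm{Var}\to P$. *)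

theory Defs
  imports "HOL-Algebra.Group"
begin

section \<open>Pocrims\<close>

record 'a pocrim = "'a partial_object" +
  pzero :: 'a  ("\<^bold>0\<index>")
  padd :: "'a \<Rightarrow> 'a \<Rightarrow> 'a"  (infixl "\<^bold>+\<index>" 65)
  pimp :: "'a \<Rightarrow> 'a \<Rightarrow> 'a"  (infixr "\<^bold>\<rightarrow>\<index>" 60)

record 'a bpocrim = "'a pocrim" +
  ptop :: 'a  ("\<^bold>1\<index>")

text \<open>Stronger elements are larger: \<open>0\<close> (truth) is the least element and
  \<open>x \<ge> y\<close> means that \<open>x\<close> entails \<open>y\<close>; so \<open>1\<close> below is falsity.\<close>

definition pge :: "('a, 'm) pocrim_scheme \<Rightarrow> 'a \<Rightarrow> 'a \<Rightarrow> bool"  (infix "\<^bold>\<ge>\<index>" 50)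
  where "x \<^bold>\<ge>\<^bsub>P\<^esub> y \<longleftrightarrow> x \<^bold>\<rightarrow>\<^bsub>P\<^esub> y = \<^bold>0\<^bsub>P\<^esub>"

locale pocrim =
  fixes P :: "('a, 'm) pocrim_scheme" (structure)
  assumes add_comm_monoid: "comm_monoid \<lparr>carrier = carrier P, mult = padd P, one = pzero P\<rparr>"
    and imp_closed: "\<lbrakk>x \<in> carrier P; y \<in> carrier P\<rbrakk> \<Longrightarrow> x \<^bold>\<rightarrow> y \<in> carrier P"
    and partial_order:
      "partial_order_on (carrier P) {(x, y). x \<in> carrier P \<and> y \<in> carrier P \<and> x \<^bold>\<ge> y}"
    and add_mono: "\<lbrakk>x \<in> carrier P; y \<in> carrier P; z \<in> carrier P; x \<^bold>\<ge> y\<rbrakk>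
      \<Longrightarrow> x \<^bold>+ z \<^bold>\<ge> y \<^bold>+ z"
    and ge_zero: "x \<in> carrier P \<Longrightarrow> x \<^bold>\<ge> \<^bold>0"
    and residuation: "\<lbrakk>x \<in> carrier P; y \<in> carrier P; z \<in> carrier P\<rbrakk>
      \<Longrightarrow> x \<^bold>+ y \<^bold>\<ge> z \<longleftrightarrow> x \<^bold>\<ge> y \<^bold>\<rightarrow> z"

locale bounded_pocrim = pocrim P for P :: "('a, 'm) bpocrim_scheme" (structure) +
  assumes top_closed: "\<^bold>1 \<in> carrier P"
    and add_top: "x \<in> carrier P \<Longrightarrow> x \<^bold>+ \<^bold>1 = \<^bold>1"

definition pneg :: "('a, 'm) bpocrim_scheme \<Rightarrow> 'a \<Rightarrow> 'a"
  where "pneg P x = x \<^bold>\<rightarrow>\<^bsub>P\<^esub> \<^bold>1\<^bsub>P\<^esub>"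

definition dneg :: "('a, 'm) bpocrim_scheme \<Rightarrow> 'a \<Rightarrow> 'a"
  where "dneg P x = pneg P (pneg P x)"

locale involutive_pocrim = bounded_pocrim P for P :: "('a, 'm) bpocrim_scheme" (structure) +
  assumes involutive: "x \<in> carrier P \<Longrightarrow> dneg P x = x"

definition bpocrim_hom :: "'a bpocrim \<Rightarrow> 'b bpocrim \<Rightarrow> ('a \<Rightarrow> 'b) set"
  where "bpocrim_hom P Q = {h. h \<in> carrier P \<rightarrow> carrier Q
    \<and> h \<^bold>0\<^bsub>P\<^esub> = \<^bold>0\<^bsub>Q\<^esub> \<and> h \<^bold>1\<^bsub>P\<^esub> = \<^bold>1\<^bsub>Q\<^esub>
    \<and> (\<forall>x \<in> carrier P. \<forall>y \<in> carrier P.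
        h (x \<^bold>+\<^bsub>P\<^esub> y) = h x \<^bold>+\<^bsub>Q\<^esub> h y
        \<and> h (x \<^bold>\<rightarrow>\<^bsub>P\<^esub> y) = h x \<^bold>\<rightarrow>\<^bsub>Q\<^esub> h y)}"


section \<open>Formulas and semantics\<close>

datatype formula =
    Var nat
  | One
  | Tensor formula formula
  | Lolli formula formula

type_synonym 'a assignment = "nat \<Rightarrow> 'a"

definition assignments :: "'a bpocrim \<Rightarrow> 'a assignment set"
  where "assignments P = UNIV \<rightarrow> carrier P"

text \<open>A family \<open>\<mu>\<close> as below assigns a function to every record; only its values at bounded
  pocrims, on assignments into the carrier, are meaningful.

  The type \<open>'a\<close> is the universe from which carriers are drawn. Naturality is stated for two
  possibly different universes; a semantics on the universe \<open>'a\<close> is natural with respect to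
  itself. In particular (take the identity as homomorphism) it does not depend on the behaviour
  of the operations outside the carrier.\<close>

type_synonym 'a family = "'a bpocrim \<Rightarrow> 'a assignment \<Rightarrow> formula \<Rightarrow> 'a"

definition is_natural :: "'a family \<Rightarrow> 'b family \<Rightarrow> bool"
  where "is_natural \<mu> \<nu> \<longleftrightarrow>
    (\<forall>P Q h \<alpha>. bounded_pocrim P \<and> bounded_pocrim Q \<and> h \<in> bpocrim_hom P Q \<and> \<alpha> \<in> assignments P
      \<longrightarrow> \<nu> Q (h \<circ> \<alpha>) = h \<circ> \<mu> P \<alpha>)"

definition is_semantics :: "'a family \<Rightarrow> bool"
  where "is_semantics \<mu> \<longleftrightarrow>
    (\<forall>P. bounded_pocrim P \<longrightarrow> (\<forall>\<alpha> \<in> assignments P. \<mu> P \<alpha> \<in> UNIV \<rightarrow> carrier P)) \<and> is_natural \<mu> \<mu>"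

primrec standard :: "'a family" where
  "standard P \<alpha> (Var i) = \<alpha> i"
| "standard P \<alpha> One = \<^bold>1\<^bsub>P\<^esub>"
| "standard P \<alpha> (Tensor A B) = standard P \<alpha> A \<^bold>+\<^bsub>P\<^esub> standard P \<alpha> B"
| "standard P \<alpha> (Lolli A B) = standard P \<alpha> A \<^bold>\<rightarrow>\<^bsub>P\<^esub> standard P \<alpha> B"

primrec kolmogorov :: "'a family" where
  "kolmogorov P \<alpha> (Var i) = dneg P (\<alpha> i)"
| "kolmogorov P \<alpha> One = \<^bold>1\<^bsub>P\<^esub>"
| "kolmogorov P \<alpha> (Tensor A B) = dneg P (kolmogorov P \<alpha> A \<^bold>+\<^bsub>P\<^esub> kolmogorov P \<alpha> B)"
| "kolmogorov P \<alpha> (Lolli A B) = dneg P (kolmogorov P \<alpha> A \<^bold>\<rightarrow>\<^bsub>P\<^esub> kolmogorov P \<alpha> B)"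


section \<open>Double negation semantics\<close>

definition dns1 :: "'a bpocrim set \<Rightarrow> 'a family \<Rightarrow> bool"
  where "dns1 C \<mu> \<longleftrightarrow>
    (\<forall>P \<in> C. involutive_pocrim P \<longrightarrow> (\<forall>\<alpha> \<in> assignments P. \<mu> P \<alpha> = standard P \<alpha>))"

definition dns2 :: "'a bpocrim set \<Rightarrow> 'a family \<Rightarrow> bool"
  where "dns2 C \<mu> \<longleftrightarrow>
    (\<forall>A. (\<forall>P \<in> C. involutive_pocrim P \<longrightarrow> (\<forall>\<alpha> \<in> assignments P. standard P \<alpha> A = \<^bold>0\<^bsub>P\<^esub>))
      \<longrightarrow> (\<forall>P \<in> C. \<forall>\<alpha> \<in> assignments P. \<mu> P \<alpha> A = \<^bold>0\<^bsub>P\<^esub>))"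

definition dns3 :: "'a bpocrim set \<Rightarrow> 'a family \<Rightarrow> bool"
  where "dns3 C \<mu> \<longleftrightarrow> (\<forall>P \<in> C. \<forall>\<alpha> \<in> assignments P. dneg P \<circ> \<mu> P \<alpha> = \<mu> P \<alpha>)"

definition double_negation_semantics :: "'a bpocrim set \<Rightarrow> 'a family \<Rightarrow> bool"
  where "double_negation_semantics C \<mu> \<longleftrightarrow>
    C \<subseteq> {P. bounded_pocrim P} \<and> is_semantics \<mu> \<and> dns1 C \<mu> \<and> dns2 C \<mu> \<and> dns3 C \<mu>"

definition all_bounded_pocrims :: "'a bpocrim set"
  where "all_bounded_pocrims = {P. bounded_pocrim P}"

end

theory Submission
  imports Defs
begin

text \<open>The elements fixed by \<open>\<delta>\<close> of a bounded pocrim form an involutive pocrim under the same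
  \<open>0\<close>, \<open>1\<close>, \<open>\<rightarrow>\<close> and the sum \<open>\<delta>(x + y)\<close>; the implication needs no correction because
  \<open>x \<rightarrow> \<not>w = \<not>(x + w)\<close>. The Kolmogorov semantics of an assignment \<open>\<alpha>\<close> is the standard semantics
  of \<open>\<delta> \<circ> \<alpha>\<close> in that involutive pocrim, which gives (DNS2).\<close>

context pocrim
begin

lemma zero_closed: "\<^bold>0 \<in> carrier P"
  using monoid.one_closed[OF comm_monoid.axioms(1)[OF add_comm_monoid]] by simp

lemma add_closed: "\<lbrakk>x \<in> carrier P; y \<in> carrier P\<rbrakk> \<Longrightarrow> x \<^bold>+ y \<in> carrier P"
  using monoid.m_closed[OF comm_monoid.axioms(1)[OF add_comm_monoid]] by simp

lemma add_assoc:
  "\<lbrakk>x \<in> carrier P; y \<in> carrier P; z \<in> carrier P\<rbrakk> \<Longrightarrow> x \<^bold>+ y \<^bold>+ z = x \<^bold>+ (y \<^bold>+ z)"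
  using monoid.m_assoc[OF comm_monoid.axioms(1)[OF add_comm_monoid]] by simp

lemma add_commute: "\<lbrakk>x \<in> carrier P; y \<in> carrier P\<rbrakk> \<Longrightarrow> x \<^bold>+ y = y \<^bold>+ x"
  using comm_monoid.m_comm[OF add_comm_monoid] by simp

lemma zero_add: "x \<in> carrier P \<Longrightarrow> \<^bold>0 \<^bold>+ x = x"
  using monoid.l_one[OF comm_monoid.axioms(1)[OF add_comm_monoid]] by simp

lemma add_zero: "x \<in> carrier P \<Longrightarrow> x \<^bold>+ \<^bold>0 = x"
  using monoid.r_one[OF comm_monoid.axioms(1)[OF add_comm_monoid]] by simp

lemma ge_refl: "x \<in> carrier P \<Longrightarrow> x \<^bold>\<ge> x"
  using partial_order by (auto simp: partial_order_on_def preorder_on_def refl_on_def)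

lemma ge_antisym: "\<lbrakk>x \<in> carrier P; y \<in> carrier P; x \<^bold>\<ge> y; y \<^bold>\<ge> x\<rbrakk> \<Longrightarrow> x = y"
  using partial_order by (auto simp: partial_order_on_def antisym_def)

lemma ge_trans:
  "\<lbrakk>x \<in> carrier P; y \<in> carrier P; z \<in> carrier P; x \<^bold>\<ge> y; y \<^bold>\<ge> z\<rbrakk> \<Longrightarrow> x \<^bold>\<ge> z"
  using partial_order unfolding partial_order_on_def preorder_on_def trans_def by blast

text \<open>Taking \<open>w\<close> to be \<open>x\<close> and then \<open>y\<close>, reflexivity
  gives both inequalities. This suits elements that are known only through residuation, such as
  implications and negations.\<close>

lemma eqI_ge:
  assumes "x \<in> carrier P" "y \<in> carrier P"
    and "\<And>w. w \<in> carrier P \<Longrightarrow> w \<^bold>\<ge> x \<longleftrightarrow> w \<^bold>\<ge> y"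
  shows "x = y"
  using assms ge_antisym ge_refl by blast

end

context bounded_pocrim
begin

lemma neg_closed: "x \<in> carrier P \<Longrightarrow> pneg P x \<in> carrier P"
  by (simp add: pneg_def imp_closed top_closed)

lemma dneg_closed: "x \<in> carrier P \<Longrightarrow> dneg P x \<in> carrier P"
  by (simp add: dneg_def neg_closed)

lemma ge_neg_iff: "\<lbrakk>x \<in> carrier P; y \<in> carrier P\<rbrakk> \<Longrightarrow> x \<^bold>\<ge> pneg P y \<longleftrightarrow> x \<^bold>+ y \<^bold>\<ge> \<^bold>1"
  by (simp add: pneg_def residuation top_closed)

text \<open>Both sides say that the sum of \<open>x\<close> and \<open>y\<close> lies above 1, which
  is symmetric in the two. So negation forms an antitone Galois connection with itself, and the laws
  of \<delta> below are the usual consequences.\<close>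

lemma neg_swap: "\<lbrakk>x \<in> carrier P; y \<in> carrier P\<rbrakk> \<Longrightarrow> x \<^bold>\<ge> pneg P y \<longleftrightarrow> y \<^bold>\<ge> pneg P x"
  by (simp add: ge_neg_iff add_commute)

lemma ge_dneg: "x \<in> carrier P \<Longrightarrow> x \<^bold>\<ge> dneg P x"
  by (simp add: dneg_def neg_swap[of x] neg_closed ge_refl)

lemma neg_antimono: "\<lbrakk>x \<in> carrier P; y \<in> carrier P; x \<^bold>\<ge> y\<rbrakk> \<Longrightarrow> pneg P y \<^bold>\<ge> pneg P x"
  by (metis dneg_closed dneg_def ge_dneg ge_trans neg_closed neg_swap)

lemma dneg_mono: "\<lbrakk>x \<in> carrier P; y \<in> carrier P; x \<^bold>\<ge> y\<rbrakk> \<Longrightarrow> dneg P x \<^bold>\<ge> dneg P y"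
  by (simp add: dneg_def neg_antimono neg_closed)

text \<open>Triple negation collapses: one inequality is \<open>ge_dneg\<close> at
  \<open>pneg P x\<close>, the other is \<open>ge_dneg\<close> at \<open>x\<close> reversed by
  \<open>neg_antimono\<close>.\<close>

lemma neg_dneg: "x \<in> carrier P \<Longrightarrow> pneg P (dneg P x) = pneg P x"
  using ge_dneg[of "pneg P x"] neg_antimono[OF _ _ ge_dneg]
  by (simp add: dneg_def ge_antisym neg_closed)

lemma dneg_neg: "x \<in> carrier P \<Longrightarrow> dneg P (pneg P x) = pneg P x"
  using neg_dneg by (simp add: dneg_def)

lemma dneg_dneg: "x \<in> carrier P \<Longrightarrow> dneg P (dneg P x) = dneg P x"
  by (simp add: dneg_def[of P x] dneg_neg neg_closed)

lemma neg_top: "pneg P \<^bold>1 = \<^bold>0"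
  using ge_refl[OF top_closed] by (simp add: pneg_def pge_def)

lemma neg_zero: "pneg P \<^bold>0 = \<^bold>1"
proof (rule eqI_ge)
  fix w assume "w \<in> carrier P"
  then show "w \<^bold>\<ge> pneg P \<^bold>0 \<longleftrightarrow> w \<^bold>\<ge> \<^bold>1"
    by (simp add: ge_neg_iff zero_closed add_zero)
qed (simp_all add: neg_closed zero_closed top_closed)

lemma dneg_top: "dneg P \<^bold>1 = \<^bold>1"
  by (simp add: dneg_def neg_top neg_zero)

lemma dneg_zero: "dneg P \<^bold>0 = \<^bold>0"
  by (simp add: dneg_def neg_top neg_zero)

text \<open>An element \<open>z\<close> lies above either side exactly when the sum of
  \<open>z\<close>, \<open>x\<close> and \<open>w\<close> lies above 1.\<close>

lemma imp_neg:
  assumes "x \<in> carrier P" "w \<in> carrier P"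
  shows "x \<^bold>\<rightarrow> pneg P w = pneg P (x \<^bold>+ w)"
proof (rule eqI_ge)
  fix z assume "z \<in> carrier P"
  then show "z \<^bold>\<ge> x \<^bold>\<rightarrow> pneg P w \<longleftrightarrow> z \<^bold>\<ge> pneg P (x \<^bold>+ w)"
    using assms by (simp add: residuation[symmetric] ge_neg_iff neg_closed add_closed add_assoc)
qed (simp_all add: assms imp_closed neg_closed add_closed)

text \<open>Such a \<open>y\<close> is the negation of \<open>pneg P y\<close>, so by
  \<open>imp_neg\<close> the implication is itself a negation, and \<delta> fixes negations.\<close>

lemma dneg_imp:
  assumes "x \<in> carrier P" "y \<in> carrier P" "dneg P y = y"
  shows "dneg P (x \<^bold>\<rightarrow> y) = x \<^bold>\<rightarrow> y"
  using imp_neg[of x "pneg P y"] assms dneg_neg[of "x \<^bold>+ pneg P y"]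
  by (simp add: dneg_def[of P y] neg_closed add_closed)

lemma dneg_dneg_add:
  assumes "x \<in> carrier P" "y \<in> carrier P"
  shows "dneg P (dneg P x \<^bold>+ y) = dneg P (x \<^bold>+ y)"
proof -
  \<comment> \<open>With \<open>y\<close> as the left summand, \<open>imp_neg\<close> read backwards
    turns each side into an implication from \<open>y\<close> to a negation, where
    \<open>neg_dneg\<close> removes the extra \<delta>.\<close>
  have "pneg P (y \<^bold>+ dneg P x) = pneg P (y \<^bold>+ x)"
    using assms by (simp add: imp_neg[symmetric] dneg_closed neg_dneg)
  then show ?thesis
    using assms by (simp add: dneg_def add_commute neg_closed)
qed

lemma dneg_add_dneg:
  "\<lbrakk>x \<in> carrier P; y \<in> carrier P\<rbrakk> \<Longrightarrow> dneg P (x \<^bold>+ dneg P y) = dneg P (x \<^bold>+ y)"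
  using dneg_dneg_add[of y x] by (simp add: add_commute dneg_closed)

text \<open>Thus \<open>dneg P x\<close> is the largest \<delta>-fixed element below
  \<open>x\<close>. Residuation in the pocrim of fixed elements rests on this.\<close>

lemma dneg_ge_iff:
  "\<lbrakk>x \<in> carrier P; z \<in> carrier P; dneg P z = z\<rbrakk> \<Longrightarrow> dneg P x \<^bold>\<ge> z \<longleftrightarrow> x \<^bold>\<ge> z"
  by (metis dneg_closed dneg_mono ge_dneg ge_trans)

end

text \<open>The fixed elements are cut out by shrinking the carrier inside the type
  \<open>'a\<close>, so the result stays in the universe over which the hypothesis of
  \<open>dns2\<close> quantifies.\<close>

definition regular_pocrim :: "'a bpocrim \<Rightarrow> 'a bpocrim"
  where "regular_pocrim P = \<lparr>carrier = {x \<in> carrier P. dneg P x = x},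
    pzero = \<^bold>0\<^bsub>P\<^esub>, padd = (\<lambda>x y. dneg P (x \<^bold>+\<^bsub>P\<^esub> y)), pimp = pimp P, ptop = \<^bold>1\<^bsub>P\<^esub>\<rparr>"

lemma regular_pocrim_simps [simp]:
  "carrier (regular_pocrim P) = {x \<in> carrier P. dneg P x = x}"
  "pzero (regular_pocrim P) = \<^bold>0\<^bsub>P\<^esub>"
  "padd (regular_pocrim P) = (\<lambda>x y. dneg P (x \<^bold>+\<^bsub>P\<^esub> y))"
  "pimp (regular_pocrim P) = pimp P"
  "ptop (regular_pocrim P) = \<^bold>1\<^bsub>P\<^esub>"
  "pge (regular_pocrim P) = pge P"
  "dneg (regular_pocrim P) = dneg P"
  by (auto simp: regular_pocrim_def pge_def dneg_def pneg_def fun_eq_iff)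

lemma involutive_regular_pocrim:
  assumes "bounded_pocrim P"
  shows "involutive_pocrim (regular_pocrim P)"
proof -
  interpret bounded_pocrim P by fact
  let ?R = "{x \<in> carrier P. dneg P x = x}"
  \<comment> \<open>For associativity, the inner \<delta> is absorbed by the outer one, so both
    bracketings become \<delta> of the plain triple sum. The unit law holds because \<delta> fixes
    the members of \<open>?R\<close>.\<close>
  have "comm_monoid \<lparr>carrier = ?R, mult = \<lambda>x y. dneg P (x \<^bold>+\<^bsub>P\<^esub> y), one = \<^bold>0\<^bsub>P\<^esub>\<rparr>"
    by (rule comm_monoidI)
      (auto simp: add_closed dneg_closed dneg_dneg zero_closed dneg_zero zero_add add_zero
        dneg_dneg_add dneg_add_dneg add_assoc intro: arg_cong[OF add_commute])
  moreover have "partial_order_on ?R {(x, y). x \<in> ?R \<and> y \<in> ?R \<and> x \<^bold>\<ge>\<^bsub>P\<^esub> y}"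
    unfolding partial_order_on_def preorder_on_def
    by (auto simp: refl_on_def ge_refl ge_antisym intro!: transI antisymI intro: ge_trans)
  moreover have "dneg P (x \<^bold>+\<^bsub>P\<^esub> z) \<^bold>\<ge>\<^bsub>P\<^esub> dneg P (y \<^bold>+\<^bsub>P\<^esub> z)"
    if "x \<in> carrier P" "y \<in> carrier P" "z \<in> carrier P" "x \<^bold>\<ge>\<^bsub>P\<^esub> y" for x y z
    using that by (intro dneg_mono add_mono add_closed)
  \<comment> \<open>In the residuation law the \<delta> around the sum is dropped by
    \<open>dneg_ge_iff\<close>, as the right-hand element is fixed; what remains is residuation in
    \<open>P\<close>.\<close>
  ultimately show ?thesis
    by (intro involutive_pocrim.intro bounded_pocrim.intro pocrim.intro
        bounded_pocrim_axioms.intro involutive_pocrim_axioms.intro)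
      (auto simp: imp_closed dneg_imp zero_closed dneg_zero add_closed ge_zero
        dneg_ge_iff residuation top_closed dneg_top add_top)
qed

lemma assignments_iff: "\<alpha> \<in> assignments P \<longleftrightarrow> range \<alpha> \<subseteq> carrier P"
  by (auto simp: assignments_def)

text \<open>Every clause except that for the constant 1 ends in \<delta>, which is idempotent, and
  \<delta> fixes 1. This yields (DNS3).\<close>

lemma kolmogorov_closed_regular:
  assumes "bounded_pocrim P" "\<alpha> \<in> assignments P"
  shows "kolmogorov P \<alpha> A \<in> carrier P \<and> dneg P (kolmogorov P \<alpha> A) = kolmogorov P \<alpha> A"
proof -
  interpret bounded_pocrim P by fact
  show ?thesis
    using assms(2)
    by (induction A) (auto simp: dneg_closed dneg_dneg top_closed dneg_top add_closed imp_closed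
        assignments_iff image_subset_iff)
qed

lemma kolmogorov_involutive:
  assumes "involutive_pocrim P" "\<alpha> \<in> assignments P"
  shows "kolmogorov P \<alpha> = standard P \<alpha>"
proof
  interpret involutive_pocrim P by fact
  have K: "kolmogorov P \<alpha> A \<in> carrier P" for A
    using kolmogorov_closed_regular[OF bounded_pocrim_axioms assms(2)] by simp
  show "kolmogorov P \<alpha> A = standard P \<alpha> A" for A
  proof (induction A)
    case (Tensor A B)
    then show ?case
      using K[of A] K[of B] by (simp add: involutive add_closed)
  next
    case (Lolli A B)
    then show ?case
      using K[of A] K[of B] by (simp add: involutive imp_closed)
  qed (use assms(2) in \<open>auto simp: involutive assignments_iff image_subset_iff\<close>)
qed

lemma kolmogorov_eq_standard_regular:
  assumes "bounded_pocrim P" "\<alpha> \<in> assignments P"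
  shows "kolmogorov P \<alpha> A = standard (regular_pocrim P) (dneg P \<circ> \<alpha>) A"
proof (induction A)
  case (Lolli A B)
  interpret bounded_pocrim P by fact
  \<comment> \<open>Only implication needs an argument: \<open>regular_pocrim\<close> has no
    \<delta> there. The induction hypotheses are used from right to left, so that the value of
    \<open>B\<close> is a Kolmogorov value, hence fixed, and \<open>dneg_imp\<close>
    applies.\<close>
  show ?case
    using kolmogorov_closed_regular[OF assms, of A] kolmogorov_closed_regular[OF assms, of B]
    unfolding kolmogorov.simps standard.simps regular_pocrim_simps Lolli[symmetric]
    by (simp add: dneg_imp)
qed simp_all

text \<open>A homomorphism preserves 1 and implication, hence commutes with \<delta>, and so with
  every clause of the recursion.\<close>

lemma hom_kolmogorov:
  assumes "bounded_pocrim P" "h \<in> bpocrim_hom P Q" "\<alpha> \<in> assignments P"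
  shows "kolmogorov Q (h \<circ> \<alpha>) A = h (kolmogorov P \<alpha> A)"
proof -
  interpret bounded_pocrim P by fact
  have h: "h \<^bold>1\<^bsub>P\<^esub> = \<^bold>1\<^bsub>Q\<^esub>"
    "\<And>x y. \<lbrakk>x \<in> carrier P; y \<in> carrier P\<rbrakk> \<Longrightarrow> h (x \<^bold>+\<^bsub>P\<^esub> y) = h x \<^bold>+\<^bsub>Q\<^esub> h y"
    "\<And>x y. \<lbrakk>x \<in> carrier P; y \<in> carrier P\<rbrakk> \<Longrightarrow> h (x \<^bold>\<rightarrow>\<^bsub>P\<^esub> y) = h x \<^bold>\<rightarrow>\<^bsub>Q\<^esub> h y"
    using assms(2) by (auto simp: bpocrim_hom_def)
  have hd: "h (dneg P x) = dneg Q (h x)" if "x \<in> carrier P" for x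
    using that by (simp add: dneg_def pneg_def h imp_closed top_closed)
  have \<alpha>: "\<alpha> i \<in> carrier P" and K: "kolmogorov P \<alpha> A \<in> carrier P" for i A
    using assms(3) kolmogorov_closed_regular[OF assms(1,3)] by (auto simp: assignments_iff)
  show ?thesis
    by (induction A) (simp_all add: h hd \<alpha> K add_closed imp_closed)
qed

lemma kolmogorov_natural: "is_natural (kolmogorov :: 'a family) (kolmogorov :: 'b family)"
  by (auto simp: is_natural_def fun_eq_iff hom_kolmogorov)

lemma dns2_kolmogorov: "dns2 all_bounded_pocrims kolmogorov"
  unfolding dns2_def
proof (intro allI impI ballI)
  fix A :: formula and P :: "'a bpocrim" and \<alpha>
  assume valid: "\<forall>P \<in> all_bounded_pocrims. involutive_pocrim P \<longrightarrow>
      (\<forall>\<alpha> \<in> assignments P. standard P \<alpha> A = (\<^bold>0\<^bsub>P\<^esub> :: 'a))"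
    and "P \<in> all_bounded_pocrims" and \<alpha>: "\<alpha> \<in> assignments P"
  then have P: "bounded_pocrim P"
    by (simp add: all_bounded_pocrims_def)
  then interpret bounded_pocrim P .
  note inv = involutive_regular_pocrim[OF P]
  then have "regular_pocrim P \<in> all_bounded_pocrims"
    by (simp add: all_bounded_pocrims_def involutive_pocrim.axioms(1))
  \<comment> \<open>Idempotence of \<delta> puts the values of this assignment among the fixed
    elements, so validity in involutive pocrims can be applied to it.\<close>
  moreover have "dneg P \<circ> \<alpha> \<in> assignments (regular_pocrim P)"
    using \<alpha> by (auto simp: assignments_iff dneg_closed dneg_dneg image_subset_iff)
  ultimately have "standard (regular_pocrim P) (dneg P \<circ> \<alpha>) A = \<^bold>0\<^bsub>regular_pocrim P\<^esub>"
    using valid inv by blast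
  then show "kolmogorov P \<alpha> A = \<^bold>0\<^bsub>P\<^esub>"
    by (simp add: kolmogorov_eq_standard_regular[OF P \<alpha>])
qed

theorem theorem5p2p3:
  shows "double_negation_semantics (all_bounded_pocrims :: 'a bpocrim set) kolmogorov
    \<and> is_natural (kolmogorov :: 'a family) (kolmogorov :: 'b family)"
proof -
  have "is_semantics (kolmogorov :: 'a family)"
    by (auto simp: is_semantics_def kolmogorov_natural kolmogorov_closed_regular)
  moreover have "dns1 (all_bounded_pocrims :: 'a bpocrim set) kolmogorov"
    by (simp add: dns1_def kolmogorov_involutive)
  moreover have "dns3 (all_bounded_pocrims :: 'a bpocrim set) kolmogorov"
    by (simp add: dns3_def all_bounded_pocrims_def fun_eq_iff kolmogorov_closed_regular)
  ultimately show ?thesis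
    by (simp add: double_negation_semantics_def all_bounded_pocrims_def[symmetric]
        dns2_kolmogorov kolmogorov_natural)
qed

end
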